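(* Let $n \geq 1$ and let $G$ be the sibling tree $ST_n$. Then the domination number of $G$ is $$\gamma(G) = \begin{cases} \frac{1}{7}(2^{n+2}+3) & \text{if } n\equiv 0 \pmod 3,\\ \frac{1}{7}(2^{n+2}-1) & \text{if } n\equiv 1 \pmod 3,\\ \frac{2}{7}(2^{n+1}-1) & \text{if } n\equiv 2 \pmod 3.\end{cases}$$
   Context: The sibling tree $ST_n$ has vertex set $\{1,2,\dots,2^{n+1}-1\}$; its edges are the edges of the complete binary tree of height $n$ in which vertex $x$ has children $2x$ and $2x+1$ (root $1$ at level $0$; vertex $v$ is at level $i$ iff $2^i\le v\le 2^{i+1}-1$), together with the sibling edges $\{2x,2x+1\}$ for every $x$ with $1\le x\le 2^n-1$. A set $S\subseteq V(G)$ is dominating if every vertex of $V(G)\setminus S$ is adjacent to some vertex of $S$; $\gamma(G)$ is the minimum cardinality of a dominating set. *)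

theory Defs
  imports Complex_Main
begin

text \<open>A finite simple graph is given by its vertex set and its edge set, the latter a set of
  two-element vertex sets.\<close>

definition adjacent :: "'a set set \<Rightarrow> 'a \<Rightarrow> 'a \<Rightarrow> bool" where
  "adjacent E u v \<longleftrightarrow> {u, v} \<in> E"

definition dominating :: "'a set \<Rightarrow> 'a set set \<Rightarrow> 'a set \<Rightarrow> bool" where
  "dominating V E S \<longleftrightarrow> S \<subseteq> V \<and> (\<forall>v \<in> V - S. \<exists>s \<in> S. adjacent E v s)"

definition domination_number :: "'a set \<Rightarrow> 'a set set \<Rightarrow> nat" where
  "domination_number V E = Min (card ` {S. dominating V E S})"

definition ST_verts :: "nat \<Rightarrow> nat set" where
  "ST_verts n = {1..2 ^ (n + 1) - 1}"

text \<open>The vertices that have children are exactly \<open>1, \<dots>, 2 ^ n - 1\<close>.\<close>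

definition binary_tree_edges :: "nat \<Rightarrow> nat set set" where
  "binary_tree_edges n =
     {{x, 2 * x} | x. x \<in> {1..2 ^ n - 1}} \<union> {{x, 2 * x + 1} | x. x \<in> {1..2 ^ n - 1}}"

definition sibling_edges :: "nat \<Rightarrow> nat set set" where
  "sibling_edges n = {{2 * x, 2 * x + 1} | x. x \<in> {1..2 ^ n - 1}}"

definition ST_edges :: "nat \<Rightarrow> nat set set" where
  "ST_edges n = binary_tree_edges n \<union> sibling_edges n"

end

theory Submission
  imports Defs
begin

text \<open>
  A set of vertices with pairwise disjoint closed neighborhoods is no larger than any dominating
  set, since a dominating set meets each of these neighborhoods. In the sibling tree of height
  \<open>n + 3\<close>, the level \<open>n + 2\<close> dominates itself and the two levels next to it, while the left children
  of its vertices have the triangles with their parent and sibling as closed neighborhoods.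
  So height \<open>n + 3\<close> adds \<open>2 ^ (n + 2)\<close> vertices to a dominating set for height \<open>n\<close> and equally many
  to a packing, and the domination number is \<open>(2 ^ (n + 2) + 3) div 7\<close>. The remainder of this
  division depends on \<open>n mod 3\<close> because \<open>2 ^ 3\<close> is 1 modulo 7.
\<close>

definition closed_neighborhood :: "'a set set \<Rightarrow> 'a \<Rightarrow> 'a set" where
  "closed_neighborhood E v = insert v {u. adjacent E v u}"

definition packing :: "'a set \<Rightarrow> 'a set set \<Rightarrow> 'a set \<Rightarrow> bool" where
  "packing V E P \<longleftrightarrow>
     P \<subseteq> V \<and> pairwise (\<lambda>u v. disjnt (closed_neighborhood E u) (closed_neighborhood E v)) P"

lemma dominating_iff_meets_closed_neighborhoods:
  "dominating V E S \<longleftrightarrow> S \<subseteq> V \<and> (\<forall>v\<in>V. \<exists>s\<in>S. s \<in> closed_neighborhood E v)"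
  unfolding dominating_def closed_neighborhood_def by blast

lemma dominating_mono_edges:
  assumes "dominating V E D" "E \<subseteq> F"
  shows "dominating V F D"
  using assms unfolding dominating_def adjacent_def by blast

lemma dominating_Un:
  assumes "dominating V E C" "dominating W E D"
  shows "dominating (V \<union> W) E (C \<union> D)"
  using assms unfolding dominating_def by blast

lemma packing_Un:
  assumes "packing V E P" "packing V E Q"
    and "\<And>p q. p \<in> P \<Longrightarrow> q \<in> Q \<Longrightarrow> disjnt (closed_neighborhood E p) (closed_neighborhood E q)"
  shows "packing V E (P \<union> Q)"
  unfolding packing_def
proof (intro conjI pairwiseI)
  show "P \<union> Q \<subseteq> V"
    using assms(1,2) by (simp add: packing_def)
  fix u v assume "u \<in> P \<union> Q" "v \<in> P \<union> Q" "u \<noteq> v"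
  then consider "u \<in> P" "v \<in> P" | "u \<in> Q" "v \<in> Q" | "u \<in> P" "v \<in> Q" | "u \<in> Q" "v \<in> P"
    by blast
  then show "disjnt (closed_neighborhood E u) (closed_neighborhood E v)"
  proof cases
    case 1
    then show ?thesis
      using assms(1) \<open>u \<noteq> v\<close> by (simp add: packing_def pairwise_def)
  next
    case 2
    then show ?thesis
      using assms(2) \<open>u \<noteq> v\<close> by (simp add: packing_def pairwise_def)
  next
    case 3
    then show ?thesis
      by (rule assms(3))
  next
    case 4
    then show ?thesis
      using assms(3) disjnt_sym by blast
  qed
qed

lemma card_packing_le_card_dominating:
  assumes "finite V" "packing V E P" "dominating V E S"
  shows "card P \<le> card S"
proof -
  have "\<forall>p\<in>P. \<exists>s\<in>S. s \<in> closed_neighborhood E p"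
    using assms(2,3) unfolding packing_def dominating_iff_meets_closed_neighborhoods by blast
  then obtain f where f: "\<And>p. p \<in> P \<Longrightarrow> f p \<in> S \<and> f p \<in> closed_neighborhood E p"
    by metis
  have "inj_on f P"
  proof (rule inj_onI, rule ccontr)
    fix p q assume "p \<in> P" "q \<in> P" "f p = f q" "p \<noteq> q"
    moreover from this have "disjnt (closed_neighborhood E p) (closed_neighborhood E q)"
      using assms(2) by (auto simp: packing_def dest: pairwiseD)
    ultimately show False
      using f[of p] f[of q] by (auto simp: disjnt_iff)
  qed
  moreover have "f ` P \<subseteq> S"
    using f by blast
  moreover have "finite S"
    using assms(1,3) by (auto simp: dominating_def intro: finite_subset)
  ultimately show ?thesis
    by (rule card_inj_on_le)
qed

lemma domination_number_eqI:
  assumes "finite V" "dominating V E D" "packing V E P" "card D \<le> card P"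
  shows "domination_number V E = card D"
  unfolding domination_number_def
proof (rule Min_eqI)
  have "{S. dominating V E S} \<subseteq> Pow V"
    by (auto simp: dominating_def)
  then show "finite (card ` {S. dominating V E S})"
    using assms(1) by (meson finite_Pow_iff finite_imageI finite_subset)
  show "card D \<le> k" if "k \<in> card ` {S. dominating V E S}" for k
    using that assms(4) card_packing_le_card_dominating[OF assms(1,3)] by fastforce
qed (use assms(2) in blast)

lemma mem_ST_verts: "v \<in> ST_verts n \<longleftrightarrow> 0 < v \<and> v < 2 ^ (n + 1)"
  by (auto simp: ST_verts_def)

lemma finite_ST_verts: "finite (ST_verts n)"
  by (simp add: ST_verts_def)

lemma ST_verts_mono: "m \<le> n \<Longrightarrow> ST_verts m \<subseteq> ST_verts n"
  by (force simp: mem_ST_verts intro: less_le_trans)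

lemma ST_edges_mono:
  assumes "m \<le> n"
  shows "ST_edges m \<subseteq> ST_edges n"
proof -
  have "{1..2 ^ m - 1} \<subseteq> {1..2 ^ n - 1 :: nat}"
    using assms by (auto intro!: diff_le_mono power_increasing)
  then show ?thesis
    unfolding ST_edges_def binary_tree_edges_def sibling_edges_def by blast
qed

lemma adjacent_ST_iff_parent:
  "adjacent (ST_edges n) v u \<longleftrightarrow> (\<exists>x. 0 < x \<and> x < 2 ^ n \<and>
     ({v, u} = {x, 2 * x} \<or> {v, u} = {x, 2 * x + 1} \<or> {v, u} = {2 * x, 2 * x + 1}))"
proof -
  have "x \<in> {1..2 ^ n - 1} \<longleftrightarrow> 0 < x \<and> x < 2 ^ n" for x :: nat
    by auto
  then show ?thesis
    unfolding adjacent_def ST_edges_def binary_tree_edges_def sibling_edges_def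
      Un_iff mem_Collect_eq by metis
qed

lemma adjacent_ST_iff:
  "adjacent (ST_edges n) v u \<longleftrightarrow> u \<noteq> v \<and> u \<in> ST_verts n \<and> v \<in> ST_verts n \<and>
     (u div 2 = v \<or> v div 2 = u \<or> u div 2 = v div 2)"  (is "_ \<longleftrightarrow> ?near")
proof
  assume "adjacent (ST_edges n) v u"
  then show ?near
    by (auto simp: adjacent_ST_iff_parent doubleton_eq_iff mem_ST_verts)
next
  assume near: ?near
  then consider "u div 2 = v" | "v div 2 = u" | "u div 2 = v div 2" "u \<noteq> v"
    by blast
  then show "adjacent (ST_edges n) v u"
  proof cases
    case 1
    then have "u = 2 * v \<or> u = 2 * v + 1" "0 < v" "v < 2 ^ n"
      using near by (auto simp: mem_ST_verts)
    then show ?thesis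
      unfolding adjacent_ST_iff_parent by blast
  next
    case 2
    then have "v = 2 * u \<or> v = 2 * u + 1" "0 < u" "u < 2 ^ n"
      using near by (auto simp: mem_ST_verts)
    then show ?thesis
      unfolding adjacent_ST_iff_parent by blast
  next
    case 3
    define x where "x = v div 2"
    with 3 have "v = 2 * x \<or> v = 2 * x + 1" "u = 2 * x \<or> u = 2 * x + 1"
      by linarith+
    with \<open>u \<noteq> v\<close> have "{v, u} = {2 * x, 2 * x + 1}" "0 < x" "x < 2 ^ n"
      using near by (auto simp: mem_ST_verts)
    then show ?thesis
      unfolding adjacent_ST_iff_parent by blast
  qed
qed

lemma mem_closed_neighborhood_ST:
  assumes "v \<in> ST_verts n"
  shows "u \<in> closed_neighborhood (ST_edges n) v \<longleftrightarrow>
    u \<in> ST_verts n \<and> (u div 2 = v \<or> v div 2 = u \<or> u div 2 = v div 2)"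
proof (cases "u = v")
  case True
  then show ?thesis
    using assms by (simp add: closed_neighborhood_def)
next
  case False
  then show ?thesis
    using assms by (simp add: closed_neighborhood_def adjacent_ST_iff)
qed

definition ST_level :: "nat \<Rightarrow> nat set" where
  "ST_level k = {2 ^ k..<2 ^ (k + 1)}"

lemma card_ST_level: "card (ST_level k) = 2 ^ k"
  by (simp add: ST_level_def)

lemma finite_ST_level: "finite (ST_level k)"
  by (simp add: ST_level_def)

lemma card_left_children_ST_level: "card ((*) 2 ` ST_level k) = 2 ^ k"
  by (simp add: card_image inj_on_def card_ST_level)

text \<open>For \<open>k = 0\<close> the truncated \<open>k - 1\<close> makes the interval start at the root.\<close>

lemma dominating_ST_level:
  "dominating {2 ^ (k - 1)..<2 ^ (k + 2)} (ST_edges (k + 1)) (ST_level k)"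
  unfolding dominating_def
proof (intro conjI ballI)
  show "ST_level k \<subseteq> {2 ^ (k - 1)..<2 ^ (k + 2)}"
    by (cases k) (auto simp: ST_level_def)
next
  fix v assume v: "v \<in> {2 ^ (k - 1)..<2 ^ (k + 2)} - ST_level k"
  then have "v \<in> ST_verts (k + 1)"
    by (auto simp: mem_ST_verts intro: less_le_trans[of 0 "2 ^ (k - 1)"])
  consider "v < 2 ^ k" | "2 ^ (k + 1) \<le> v"
    using v by (force simp: ST_level_def)
  then show "\<exists>s\<in>ST_level k. adjacent (ST_edges (k + 1)) v s"
  proof cases
    case 1
    then have "2 * v \<in> ST_level k"
      using v by (cases k) (auto simp: ST_level_def)
    moreover have "adjacent (ST_edges (k + 1)) v (2 * v)"
      using \<open>v \<in> ST_verts (k + 1)\<close> 1 by (auto simp: adjacent_ST_iff mem_ST_verts)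
    ultimately show ?thesis by blast
  next
    case 2
    then have "v div 2 \<in> ST_level k"
      using v by (auto simp: ST_level_def)
    moreover from this have "adjacent (ST_edges (k + 1)) v (v div 2)"
      using \<open>v \<in> ST_verts (k + 1)\<close> by (auto simp: adjacent_ST_iff mem_ST_verts ST_level_def)
    ultimately show ?thesis by blast
  qed
qed

lemma left_child_mem_ST_verts:
  assumes "v \<in> ST_level k"
  shows "2 * v \<in> ST_verts (k + 1)"
  using assms by (auto simp: ST_level_def mem_ST_verts intro: less_le_trans[of 0 "2 ^ k"])

lemma closed_neighborhood_left_child:
  assumes "v \<in> ST_level k"
  shows "closed_neighborhood (ST_edges (k + 1)) (2 * v) = {v, 2 * v, 2 * v + 1}"
proof -
  have "0 < v" "2 ^ k \<le> v" "v < 2 ^ (k + 1)"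
    using assms by (auto simp: ST_level_def intro: less_le_trans[of 0 "2 ^ k"])
  then show ?thesis
    using left_child_mem_ST_verts[OF assms]
    by (auto simp: mem_closed_neighborhood_ST mem_ST_verts)
qed

lemma packing_left_children_ST_level:
  "packing (ST_verts (k + 1)) (ST_edges (k + 1)) ((*) 2 ` ST_level k)"
  unfolding packing_def pairwise_image
proof (intro conjI pairwiseI)
  show "(*) 2 ` ST_level k \<subseteq> ST_verts (k + 1)"
    using left_child_mem_ST_verts by blast
next
  fix v w assume "v \<in> ST_level k" "w \<in> ST_level k" "v \<noteq> w"
  moreover from this have "disjnt {v, 2 * v, 2 * v + 1} {w, 2 * w, 2 * w + 1}"
    by (auto simp: ST_level_def)
  ultimately show "2 * v \<noteq> 2 * w \<longrightarrow> disjnt (closed_neighborhood (ST_edges (k + 1)) (2 * v))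
      (closed_neighborhood (ST_edges (k + 1)) (2 * w))"
    by (simp only: closed_neighborhood_left_child simp_thms)
qed

lemma closed_neighborhood_ST_eq_Un:
  assumes "v \<in> ST_verts m" "m \<le> n"
  shows "closed_neighborhood (ST_edges n) v =
    closed_neighborhood (ST_edges m) v \<union> {u \<in> ST_verts n - ST_verts m. u div 2 = v}"
proof -
  have "v \<in> ST_verts n" "ST_verts m \<subseteq> ST_verts n"
    using assms ST_verts_mono by blast+
  moreover have "v div 2 < 2 ^ m"
    using assms(1) by (auto simp: mem_ST_verts)
  then have "u \<in> ST_verts m" if "u \<in> ST_verts n" "v div 2 = u \<or> u div 2 = v div 2" for u
    using that by (auto simp: mem_ST_verts)
  ultimately show ?thesis
    using assms(1) by (auto simp: mem_closed_neighborhood_ST)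
qed

lemma packing_ST_mono:
  assumes "packing (ST_verts m) (ST_edges m) P" "m \<le> n"
  shows "packing (ST_verts n) (ST_edges n) P"
  unfolding packing_def
proof (intro conjI pairwiseI)
  have P: "P \<subseteq> ST_verts m"
    using assms(1) by (simp add: packing_def)
  then show "P \<subseteq> ST_verts n"
    using ST_verts_mono[OF assms(2)] by blast
  have within: "closed_neighborhood (ST_edges m) p \<subseteq> ST_verts m" if "p \<in> P" for p
    using that P mem_closed_neighborhood_ST by blast
  have taller: "closed_neighborhood (ST_edges n) p =
      closed_neighborhood (ST_edges m) p \<union> {u \<in> ST_verts n - ST_verts m. u div 2 = p}"
    if "p \<in> P" for p
    using that P assms(2) by (blast intro!: closed_neighborhood_ST_eq_Un)
  fix p q assume pq: "p \<in> P" "q \<in> P" "p \<noteq> q"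
  then have "disjnt (closed_neighborhood (ST_edges m) p) (closed_neighborhood (ST_edges m) q)"
    using assms(1) by (auto simp: packing_def dest: pairwiseD)
  then show "disjnt (closed_neighborhood (ST_edges n) p) (closed_neighborhood (ST_edges n) q)"
    unfolding taller[OF pq(1)] taller[OF pq(2)] disjnt_iff
    using within[OF pq(1)] within[OF pq(2)] pq(3) by blast
qed

lemma disjnt_closed_neighborhood_left_child:
  assumes "u \<in> ST_verts n" "v \<in> ST_level k" "n + 2 \<le> k"
  shows "disjnt (closed_neighborhood (ST_edges (k + 1)) u)
    (closed_neighborhood (ST_edges (k + 1)) (2 * v))"
proof -
  have "u \<in> ST_verts (k + 1)"
    using assms(1,3) ST_verts_mono[of n "k + 1"] by auto
  then have "closed_neighborhood (ST_edges (k + 1)) u \<subseteq> {..<2 ^ (n + 2)}"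
    using assms(1) by (auto simp: mem_closed_neighborhood_ST mem_ST_verts)
  also have "\<dots> \<subseteq> {..<2 ^ k}"
    using power_increasing[OF assms(3), of "2::nat"] by simp
  finally show ?thesis
    using assms(2) unfolding closed_neighborhood_left_child[OF assms(2)]
    by (auto simp: disjnt_iff ST_level_def)
qed

fun ST_dominating_set :: "nat \<Rightarrow> nat set" where
  "ST_dominating_set 0 = {1}"
| "ST_dominating_set (Suc 0) = ST_level 0"
| "ST_dominating_set (Suc (Suc 0)) = ST_level 1"
| "ST_dominating_set (Suc (Suc (Suc n))) = ST_dominating_set n \<union> ST_level (n + 2)"

fun ST_packing :: "nat \<Rightarrow> nat set" where
  "ST_packing 0 = {1}"
| "ST_packing (Suc 0) = (*) 2 ` ST_level 0"
| "ST_packing (Suc (Suc 0)) = (*) 2 ` ST_level 1"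
| "ST_packing (Suc (Suc (Suc n))) = ST_packing n \<union> (*) 2 ` ST_level (n + 2)"

lemma dominating_ST_dominating_set:
  "dominating (ST_verts n) (ST_edges n) (ST_dominating_set n)"
proof (induction n rule: ST_dominating_set.induct)
  case 1
  show ?case
    by (auto simp: dominating_def ST_verts_def)
next
  case 2
  have "{2 ^ (0 - 1)..<2 ^ (0 + 2)} = ST_verts 1"
    by (auto simp: mem_ST_verts)
  then show ?case
    using dominating_ST_level[of 0] by simp
next
  case 3
  have "{2 ^ (1 - 1)..<2 ^ (1 + 2)} = ST_verts 2"
    by (auto simp: mem_ST_verts)
  then show ?case
    using dominating_ST_level[of 1] by (simp add: numeral_2_eq_2)
next
  case (4 n)
  have "dominating (ST_verts n) (ST_edges (n + 3)) (ST_dominating_set n)"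
    using 4 ST_edges_mono by (rule dominating_mono_edges) simp
  moreover have "dominating {2 ^ (n + 1)..<2 ^ (n + 4)} (ST_edges (n + 3)) (ST_level (n + 2))"
    using dominating_ST_level[of "n + 2"] by (simp add: eval_nat_numeral)
  ultimately have "dominating (ST_verts n \<union> {2 ^ (n + 1)..<2 ^ (n + 4)}) (ST_edges (n + 3))
      (ST_dominating_set n \<union> ST_level (n + 2))"
    by (rule dominating_Un)
  moreover have "ST_verts n \<union> {2 ^ (n + 1)..<2 ^ (n + 4)} = ST_verts (n + 3)"
    by (auto simp: mem_ST_verts power_add intro: less_le_trans[of 0 "2 * 2 ^ n"])
  ultimately show ?case
    by (simp add: eval_nat_numeral)
qed

lemma packing_ST_packing: "packing (ST_verts n) (ST_edges n) (ST_packing n)"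
proof (induction n rule: ST_packing.induct)
  case 1
  show ?case
    by (simp add: packing_def ST_verts_def)
next
  case 2
  show ?case
    using packing_left_children_ST_level[of 0] by simp
next
  case 3
  show ?case
    using packing_left_children_ST_level[of 1] by (simp add: eval_nat_numeral)
next
  case (4 n)
  have "packing (ST_verts (n + 3)) (ST_edges (n + 3))
      (ST_packing n \<union> (*) 2 ` ST_level (n + 2))"
  proof (rule packing_Un)
    show "packing (ST_verts (n + 3)) (ST_edges (n + 3)) (ST_packing n)"
      using 4 by (rule packing_ST_mono) simp
    show "packing (ST_verts (n + 3)) (ST_edges (n + 3)) ((*) 2 ` ST_level (n + 2))"
      using packing_left_children_ST_level[of "n + 2"] by (simp add: eval_nat_numeral)
  next
    fix p q assume "p \<in> ST_packing n" "q \<in> (*) 2 ` ST_level (n + 2)"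
    moreover have "ST_packing n \<subseteq> ST_verts n"
      using 4 by (simp add: packing_def)
    ultimately show "disjnt (closed_neighborhood (ST_edges (n + 3)) p)
        (closed_neighborhood (ST_edges (n + 3)) q)"
      using disjnt_closed_neighborhood_left_child[of p n _ "n + 2"] by (auto simp: eval_nat_numeral)
  qed
  then show ?case
    by (simp add: eval_nat_numeral)
qed

lemma card_Un_beyond_ST_verts:
  assumes "A \<subseteq> ST_verts n" "finite B" "\<And>b. b \<in> B \<Longrightarrow> 2 ^ (n + 1) \<le> b"
  shows "card (A \<union> B) = card A + card B"
proof (rule card_Un_disjoint)
  show "finite A"
    using assms(1) finite_ST_verts by (rule finite_subset)
  show "A \<inter> B = {}"
    using assms(1,3) by (fastforce simp: mem_ST_verts)
qed (rule assms(2))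

lemma card_ST_dominating_set: "card (ST_dominating_set n) = (2 ^ (n + 2) + 3) div 7"
proof (induction n rule: ST_dominating_set.induct)
  case (4 n)
  have "ST_dominating_set n \<subseteq> ST_verts n"
    using dominating_ST_dominating_set by (simp add: dominating_def)
  then have "card (ST_dominating_set n \<union> ST_level (n + 2)) =
      card (ST_dominating_set n) + 2 ^ (n + 2)"
    by (subst card_Un_beyond_ST_verts) (auto simp: card_ST_level finite_ST_level ST_level_def)
  then show ?case
    by (simp add: 4)
qed (simp_all add: card_ST_level)

lemma card_ST_packing: "card (ST_packing n) = (2 ^ (n + 2) + 3) div 7"
proof (induction n rule: ST_packing.induct)
  case (4 n)
  have "ST_packing n \<subseteq> ST_verts n"
    using packing_ST_packing by (simp add: packing_def)
  then have "card (ST_packing n \<union> (*) 2 ` ST_level (n + 2)) =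
      card (ST_packing n) + 2 ^ (n + 2)"
    by (subst card_Un_beyond_ST_verts, unfold card_left_children_ST_level)
      (auto simp: finite_ST_level ST_level_def)
  then show ?case
    by (simp add: 4)
qed (simp_all add: card_left_children_ST_level)

theorem domination_number_ST:
  "domination_number (ST_verts n) (ST_edges n) = (2 ^ (n + 2) + 3) div 7"
  using domination_number_eqI[OF finite_ST_verts dominating_ST_dominating_set packing_ST_packing]
  by (simp add: card_ST_dominating_set card_ST_packing)

lemma power_2_mod_7: "(2::nat) ^ n mod 7 = 2 ^ (n mod 3)"
proof -
  have "(2::nat) ^ n = (2 ^ 3) ^ (n div 3) * 2 ^ (n mod 3)"
    by (simp only: power_mult[symmetric] power_add[symmetric] mult_div_mod_eq)
  moreover have "((2::nat) ^ 3) ^ (n div 3) mod 7 = 1"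
    using power_mod[of "2 ^ 3 :: nat" 7 "n div 3"] by simp
  ultimately have "(2::nat) ^ n mod 7 = 2 ^ (n mod 3) mod 7"
    by (metis mod_mult_left_eq mult_1)
  moreover have "n mod 3 = 0 \<or> n mod 3 = 1 \<or> n mod 3 = 2"
    by presburger
  then have "(2::nat) ^ (n mod 3) < 7"
    by auto
  ultimately show ?thesis
    by simp
qed

theorem theorem5:
  fixes n :: nat
  assumes "n \<ge> 1"
  shows "real (domination_number (ST_verts n) (ST_edges n)) =
    (if n mod 3 = 0 then 1 / 7 * (2 ^ (n + 2) + 3)
     else if n mod 3 = 1 then 1 / 7 * (2 ^ (n + 2) - 1)
     else 2 / 7 * (2 ^ (n + 1) - 1))"
proof -
  let ?N = "2 ^ (n + 2) + 3 :: nat"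
  have "?N mod 7 = (2 ^ ((n + 2) mod 3) + 3) mod 7"
    by (simp only: flip: mod_add_left_eq[of "2 ^ (n + 2)"] power_2_mod_7)
  also have "(n + 2) mod 3 = (if n mod 3 = 0 then 2 else if n mod 3 = 1 then 0 else 1)"
    by presburger
  finally have residue: "?N mod 7 = (if n mod 3 = 0 then 0 else if n mod 3 = 1 then 4 else 5)"
    by (simp split: if_splits)
  have "7 * real (?N div 7) + real (?N mod 7) = real ?N"
    by (metis mult_div_mod_eq of_nat_add of_nat_mult of_nat_numeral)
  then show ?thesis
    unfolding domination_number_ST residue by (simp add: field_simps split: if_splits)
qed

end
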